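(* Let $n\ge2$ and $m,l\ge2$ be integers. The following two statements are true: (i) The set $$\Sigma:=\{(\Lambda,\boldsymbol a,\Theta,\boldsymbol b,K,\boldsymbol x)\in\mathcal F_{m,n}\times\mathbb R^n\times\mathcal F_{l,n}\times\mathbb R^n\times\mathscr C(\mathbb R^n)\times\mathbb R^n\mid\boldsymbol x\in\mathrm{SOL}(\Lambda,\boldsymbol a,\Theta,\boldsymbol b,K)\}$$ is closed in the product space $\mathcal F_{m,n}\times\mathbb R^n\times\mathcal F_{l,n}\times\mathbb R^n\times\mathscr C(\mathbb R^n)\times\mathbb R^n$. In particular, for any $\bar\Xi:=(\bar\Lambda,\bar{\boldsymbol a},\bar\Theta,\bar{\boldsymbol b},\bar K)\in\mathcal F_{m,n}\times\mathbb R^n\times\mathcal F_{l,n}\times\mathbb R^n\times\mathscr C(\mathbb R^n)$, $\mathrm{SOL}(\bar\Xi)$ is a closed subset of $\mathbb R^n$. (ii) Let $\bar\Xi:=(\bar\Lambda,\bar{\boldsymbol a},\bar\Theta,\bar{\boldsymbol b},\bar K)\in\mathcal F_{m,n}\times\mathbb R^n\times\mathcal F_{l,n}\times\mathbb R^n\times\mathscr C(\mathbb R^n)$. If the leading tensor pair $(\bar{\mathcal A}^{(1)},\bar{\mathcal B}^{(1)})$ in $(\bar\Lambda,\bar\Theta)$ is an $\mathbf R_0^{\bar K}$-tensor pair, then the mapping $\mathrm{SOL}(\cdot)$ is locally bounded at $\bar\Xi$, i.e., $\bigcup_{(\Lambda,\boldsymbol a,\Theta,\boldsymbol b,K)\in\mathcal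 N}\mathrm{SOL}(\Lambda,\boldsymbol a,\Theta,\boldsymbol b,K)$ is bounded for some neighborhood $\mathcal N$ of $\bar\Xi$.
   Context: $\mathbb T_{m,n}$ is the space of real $m$-th order $n$-dimensional square tensors $\mathcal A=(a_{j_1\ldots j_m})$, $1\le j_1,\ldots,j_m\le n$, with Frobenius norm $\|\mathcal A\|_F=(\sum a_{j_1\ldots j_m}^2)^{1/2}$. $\mathcal F_{m,n}:=\mathbb T_{m,n}\times\mathbb T_{m-1,n}\times\cdots\times\mathbb T_{2,n}$, with elements written $\Lambda=(\mathcal A^{(1)},\ldots,\mathcal A^{(m-1)})$, $\mathcal A^{(k)}\in\mathbb T_{m-k+1,n}$, and distance $\|\Lambda_1-\Lambda_2\|_F=\big(\sum_{k=1}^{m-1}\|\mathcal A_1^{(k)}-\mathcal A_2^{(k)}\|_F^2\big)^{1/2}$; elements of $\mathcal F_{l,n}$ are written $\Theta=(\mathcal B^{(1)},\ldots,\mathcal B^{(l-1)})$. The leading tensor pair of $(\Lambda,\Theta)$ is $(\mathcal A^{(1)},\mathcal B^{(1)})$. For $\mathcal A\in\mathbb T_{m,n}$ and $\boldsymbol x\in\mathbb R^n$, $\mathcal A\boldsymbol x^{m-1}\in\mathbb R^n$ has $j$-th component $\sum_{j_2,\ldots,j_m=1}^n a_{jj_2\ldots j_m}x_{j_2}\cdots x_{j_m}$. $\mathscr C(\mathbb R^n)$ is the set of nonzero closed convex cones in $\mathbb R^n$, with metric $\delta(K_1,K_2):=\sup_{\|\boldsymbol z\|\le1}|\mathrm{dist}(\boldsymbol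 z,K_1)-\mathrm{dist}(\boldsymbol z,K_2)|$, where $\mathrm{dist}(\boldsymbol z,K)=\inf_{\boldsymbol u\in K}\|\boldsymbol z-\boldsymbol u\|$. Products carry the product topology. The dual cone of $K$ is $K^*:=\{\boldsymbol y\in\mathbb R^n\mid\langle\boldsymbol y,\boldsymbol x\rangle\ge0\ \forall\boldsymbol x\in K\}$. $\mathrm{SOL}(\Lambda,\boldsymbol a,\Theta,\boldsymbol b,K)$ is the set of all $\boldsymbol x\in\mathbb R^n$ with $F(\boldsymbol x)\in K$, $G(\boldsymbol x)\in K^*$, $\langle F(\boldsymbol x),G(\boldsymbol x)\rangle=0$, where $F(\boldsymbol x):=\sum_{k=1}^{m-1}\mathcal A^{(k)}\boldsymbol x^{m-k}+\boldsymbol a$ and $G(\boldsymbol x):=\sum_{p=1}^{l-1}\mathcal B^{(p)}\boldsymbol x^{l-p}+\boldsymbol b$. $\mathrm{SOL}(\cdot)$ is regarded as a set-valued mapping from $\mathcal F_{m,n}\times\mathbb R^n\times\mathcal F_{l,n}\times\mathbb R^n\times\mathscr C(\mathbb R^n)$ to subsets of $\mathbb R^n$. A pair $(\mathcal A,\mathcal B)\in\mathbb T_{m,n}\times\mathbb T_{l,n}$ is an $\mathbf R_0^K$-tensor pair if there exists no $\boldsymbol x\in\mathbb R^n\setminus\{\boldsymbol 0\}$ such that $\mathcal A\boldsymbol x^{m-1}\in K$, $\mathcal B\boldsymbol x^{l-1}\in K^*$ and $\langle\mathcal A\boldsymbol x^{m-1},\mathcal B\boldsymbol x^{l-1}\rangle=0$.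 *)

theory Defs
  imports "HOL-Analysis.Analysis"
begin

text \<open>An entry \<open>a\<^sub>j\<^sub>1\<^sub>.\<^sub>.\<^sub>.\<^sub>j\<^sub>m\<close> is \<open>A [j\<^sub>1, \<dots>, j\<^sub>m]\<close>; the dimension is \<open>CARD('n)\<close>. Functions are
  \<open>undefined\<close> off the indices of length \<open>m\<close>, so that equality of tensors is equality of entries.\<close>

definition tensors :: "nat \<Rightarrow> ('n::finite list \<Rightarrow> real) set" where
  "tensors m = {js. length js = m} \<rightarrow>\<^sub>E UNIV"

definition frob_norm :: "nat \<Rightarrow> ('n::finite list \<Rightarrow> real) \<Rightarrow> real" where
  "frob_norm m A = sqrt (\<Sum>js | length js = m. (A js)\<^sup>2)"

text \<open>\<open>tensor_apply m A x\<close> is \<open>A x\<^sup>m\<^sup>-\<^sup>1\<close>.\<close>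

definition tensor_apply :: "nat \<Rightarrow> ('n::finite list \<Rightarrow> real) \<Rightarrow> real^'n \<Rightarrow> real^'n" where
  "tensor_apply m A x =
     (\<chi> j. \<Sum>js | length js = m - 1. A (j # js) * (\<Prod>i<m - 1. x $ (js ! i)))"

text \<open>\<open>\<Lambda> k\<close> is \<open>A\<^sup>(\<^sup>k\<^sup>)\<close>, a tensor of order \<open>m - k + 1\<close>; in particular the leading tensor is \<open>\<Lambda> 1\<close>.\<close>

definition tensor_tuples :: "nat \<Rightarrow> (nat \<Rightarrow> 'n::finite list \<Rightarrow> real) set" where
  "tensor_tuples m = (\<Pi>\<^sub>E k\<in>{1..m - 1}. tensors (m - k + 1))"

definition tuple_dist ::
  "nat \<Rightarrow> (nat \<Rightarrow> 'n::finite list \<Rightarrow> real) \<Rightarrow> (nat \<Rightarrow> 'n list \<Rightarrow> real) \<Rightarrow> real" where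
  "tuple_dist m \<Lambda>1 \<Lambda>2 =
     sqrt (\<Sum>k=1..m - 1. (frob_norm (m - k + 1) (\<lambda>js. \<Lambda>1 k js - \<Lambda>2 k js))\<^sup>2)"

definition tuple_topology :: "nat \<Rightarrow> (nat \<Rightarrow> 'n::finite list \<Rightarrow> real) topology" where
  "tuple_topology m = Metric_space.mtopology (tensor_tuples m) (tuple_dist m)"

definition poly_map ::
  "nat \<Rightarrow> (nat \<Rightarrow> 'n::finite list \<Rightarrow> real) \<Rightarrow> real^'n \<Rightarrow> real^'n \<Rightarrow> real^'n" where
  "poly_map m \<Lambda> a x = (\<Sum>k=1..m - 1. tensor_apply (m - k + 1) (\<Lambda> k) x) + a"

definition closed_cones :: "(real^'n) set set" where
  "closed_cones = {K. closed K \<and> convex_cone K \<and> K \<noteq> {0}}"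

definition cone_dist :: "(real^'n) set \<Rightarrow> (real^'n) set \<Rightarrow> real" where
  "cone_dist K1 K2 = (SUP z\<in>cball 0 1. \<bar>infdist z K1 - infdist z K2\<bar>)"

definition cone_topology :: "(real^'n) set topology" where
  "cone_topology = Metric_space.mtopology closed_cones cone_dist"

definition dual_cone :: "(real^'n) set \<Rightarrow> (real^'n) set" where
  "dual_cone K = {y. \<forall>x\<in>K. y \<bullet> x \<ge> 0}"

type_synonym 'n param =
  "(nat \<Rightarrow> 'n list \<Rightarrow> real) \<times> (real^'n) \<times> (nat \<Rightarrow> 'n list \<Rightarrow> real) \<times> (real^'n) \<times> (real^'n) set"

definition params :: "nat \<Rightarrow> nat \<Rightarrow> 'n::finite param set" where
  "params m l = tensor_tuples m \<times> UNIV \<times> tensor_tuples l \<times> UNIV \<times> closed_cones"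

definition param_topology :: "nat \<Rightarrow> nat \<Rightarrow> 'n::finite param topology" where
  "param_topology m l =
     prod_topology (tuple_topology m) (prod_topology euclidean
       (prod_topology (tuple_topology l) (prod_topology euclidean cone_topology)))"

definition SOL :: "nat \<Rightarrow> nat \<Rightarrow> 'n::finite param \<Rightarrow> (real^'n) set" where
  "SOL m l = (\<lambda>(\<Lambda>, a, \<Theta>, b, K).
     {x. poly_map m \<Lambda> a x \<in> K \<and> poly_map l \<Theta> b x \<in> dual_cone K \<and>
         poly_map m \<Lambda> a x \<bullet> poly_map l \<Theta> b x = 0})"

definition R0_tensor_pair ::
  "nat \<Rightarrow> nat \<Rightarrow> (real^'n) set \<Rightarrow> ('n::finite list \<Rightarrow> real) \<Rightarrow> ('n list \<Rightarrow> real) \<Rightarrow> bool" where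
  "R0_tensor_pair m l K A B \<longleftrightarrow>
     \<not> (\<exists>x. x \<noteq> 0 \<and> tensor_apply m A x \<in> K \<and> tensor_apply l B x \<in> dual_cone K \<and>
            tensor_apply m A x \<bullet> tensor_apply l B x = 0)"

text \<open>A neighbourhood of \<open>p\<close> is any subset of the space that contains an open set around \<open>p\<close>.\<close>

definition locally_bounded_at ::
  "'p topology \<Rightarrow> ('p \<Rightarrow> 'b::metric_space set) \<Rightarrow> 'p \<Rightarrow> bool" where
  "locally_bounded_at T S p \<longleftrightarrow>
     (\<exists>N \<subseteq> topspace T. (\<exists>U. openin T U \<and> p \<in> U \<and> U \<subseteq> N) \<and> bounded (\<Union>q\<in>N. S q))"

text \<open>\<open>Metric_space.mtopology\<close> is meaningful only for metrics; both distances above are.\<close>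

lemma finite_index_lists: "finite {js :: 'n::finite list. length js = m}"
  using finite_lists_length_eq[of "UNIV :: 'n set" m] by simp

lemma frob_norm_L2: "frob_norm m A = L2_set A {js. length js = m}"
  by (simp add: frob_norm_def L2_set_def)

lemma tuple_dist_L2:
  "tuple_dist m \<Lambda>1 \<Lambda>2 = L2_set (\<lambda>k. frob_norm (m - k + 1) (\<lambda>js. \<Lambda>1 k js - \<Lambda>2 k js)) {1..m - 1}"
  by (simp add: tuple_dist_def L2_set_def)

lemma Metric_space_tensor_tuples:
  "Metric_space (tensor_tuples m :: (nat \<Rightarrow> 'n::finite list \<Rightarrow> real) set) (tuple_dist m)"
proof
  fix x y z :: "nat \<Rightarrow> 'n list \<Rightarrow> real"
  show "0 \<le> tuple_dist m x y" by (simp add: tuple_dist_L2)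
  show "tuple_dist m x y = tuple_dist m y x"
    by (simp add: tuple_dist_def frob_norm_def power2_commute)
  have "tuple_dist m x z \<le> L2_set (\<lambda>k. frob_norm (m - k + 1) (\<lambda>js. x k js - y k js) +
          frob_norm (m - k + 1) (\<lambda>js. y k js - z k js)) {1..m - 1}"
    unfolding tuple_dist_L2
  proof (rule L2_set_mono)
    fix k
    show "frob_norm (m - k + 1) (\<lambda>js. x k js - z k js)
        \<le> frob_norm (m - k + 1) (\<lambda>js. x k js - y k js) + frob_norm (m - k + 1) (\<lambda>js. y k js - z k js)"
      using L2_set_triangle_ineq[of "\<lambda>js. x k js - y k js" "\<lambda>js. y k js - z k js"
          "{js. length js = m - k + 1}"]
      by (simp add: frob_norm_L2)
    show "0 \<le> frob_norm (m - k + 1) (\<lambda>js. x k js - z k js)" by (simp add: frob_norm_L2)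
  qed
  also have "\<dots> \<le> tuple_dist m x y + tuple_dist m y z"
    unfolding tuple_dist_L2 by (rule L2_set_triangle_ineq)
  finally show "tuple_dist m x z \<le> tuple_dist m x y + tuple_dist m y z" .
  assume x: "x \<in> tensor_tuples m" and y: "y \<in> tensor_tuples m"
  show "tuple_dist m x y = 0 \<longleftrightarrow> x = y"
  proof
    assume "tuple_dist m x y = 0"
    then have eq: "x k js = y k js" if "k \<in> {1..m - 1}" "length js = m - k + 1" for k js
      using that by (auto simp: tuple_dist_L2 frob_norm_L2 L2_set_eq_0_iff finite_index_lists)
    show "x = y"
    proof (rule PiE_ext[OF x[unfolded tensor_tuples_def] y[unfolded tensor_tuples_def]])
      fix k assume k: "k \<in> {1..m - 1}"
      then have "x k \<in> tensors (m - k + 1)" "y k \<in> tensors (m - k + 1)"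
        using x y unfolding tensor_tuples_def by blast+
      then show "x k = y k"
        unfolding tensors_def by (rule PiE_ext) (use eq k in auto)
    qed
  qed (simp add: tuple_dist_def frob_norm_def)
qed

lemma infdist_cone_le_norm: "K \<in> closed_cones \<Longrightarrow> infdist z K \<le> norm z"
  using infdist_le[of 0 K z] by (auto simp: closed_cones_def convex_cone_iff)

lemma infdist_cone_diff_le:
  assumes "K1 \<in> closed_cones" "K2 \<in> closed_cones" "norm z \<le> 1"
  shows "\<bar>infdist z K1 - infdist z K2\<bar> \<le> 1"
  using infdist_cone_le_norm[OF assms(1), of z] infdist_cone_le_norm[OF assms(2), of z] assms(3)
    infdist_nonneg[of z K1] infdist_nonneg[of z K2] by linarith

lemma cone_dist_upper:
  assumes "K1 \<in> closed_cones" "K2 \<in> closed_cones" "norm z \<le> 1"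
  shows "\<bar>infdist z K1 - infdist z K2\<bar> \<le> cone_dist K1 K2"
  unfolding cone_dist_def
  by (rule cSUP_upper) (use assms in \<open>auto intro!: bdd_aboveI2[where M = 1] infdist_cone_diff_le\<close>)

lemma cone_dist_zero_subset:
  assumes K: "K1 \<in> closed_cones" "K2 \<in> closed_cones" and 0: "cone_dist K1 K2 = 0"
  shows "K1 \<subseteq> K2"
proof
  fix x assume x: "x \<in> K1"
  have cc: "convex_cone K1" "convex_cone K2" "closed K2" "K2 \<noteq> {}"
    using K by (auto simp: closed_cones_def convex_cone_iff)
  define c where "c = 1 + norm x"
  have c: "c > 0" by (simp add: c_def add_pos_nonneg)
  define z where "z = (1 / c) *\<^sub>R x"
  have "z \<in> K1" using convex_cone_scaleR[OF cc(1) _ x, of "1 / c"] c by (simp add: z_def)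
  moreover have "norm z \<le> 1" using c by (simp add: z_def c_def field_simps)
  ultimately have "infdist z K2 = 0" using cone_dist_upper[OF K, of z] 0 by simp
  then have "z \<in> K2" using in_closed_iff_infdist_zero[OF cc(3,4)] by simp
  then have "c *\<^sub>R z \<in> K2" using convex_cone_scaleR[OF cc(2)] c by simp
  then show "x \<in> K2" using c by (simp add: z_def)
qed

lemma cone_dist_commute: "cone_dist K1 K2 = cone_dist K2 K1"
  by (simp add: cone_dist_def abs_minus_commute)

text \<open>\<open>Metric_space\<close> asks for nonnegativity and symmetry on the whole type, where the supremum in
  \<open>cone_dist\<close> is still finite: \<open>infdist\<close> is 1-Lipschitz also for sets that are not cones.\<close>

lemma cone_dist_nonneg: "0 \<le> cone_dist K1 K2"
proof -
  have "\<bar>infdist z K1 - infdist z K2\<bar> \<le> infdist 0 K1 + infdist 0 K2 + 2" if "z \<in> cball 0 1" for z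
    using that infdist_triangle[of z K1 0] infdist_triangle[of z K2 0]
      infdist_nonneg[of z K1] infdist_nonneg[of z K2]
      infdist_nonneg[of 0 K1] infdist_nonneg[of 0 K2]
    by simp
  then have "bdd_above ((\<lambda>z. \<bar>infdist z K1 - infdist z K2\<bar>) ` cball 0 1)"
    by (rule bdd_aboveI2)
  then have "\<bar>infdist 0 K1 - infdist 0 K2\<bar> \<le> cone_dist K1 K2"
    unfolding cone_dist_def by (rule cSUP_upper[rotated]) simp
  then show ?thesis by linarith
qed

lemma Metric_space_closed_cones: "Metric_space closed_cones cone_dist"
proof
  fix K1 K2 K3 :: "(real^'a) set"
  show "0 \<le> cone_dist K1 K2" by (rule cone_dist_nonneg)
  show "cone_dist K1 K2 = cone_dist K2 K1" by (rule cone_dist_commute)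
  assume K: "K1 \<in> closed_cones" "K2 \<in> closed_cones"
  show "cone_dist K1 K2 = 0 \<longleftrightarrow> K1 = K2"
    using cone_dist_zero_subset[OF K] cone_dist_zero_subset[OF K(2,1)] cone_dist_commute[of K1 K2]
    by (auto simp: cone_dist_def)
  assume K3: "K3 \<in> closed_cones"
  show "cone_dist K1 K3 \<le> cone_dist K1 K2 + cone_dist K2 K3"
    unfolding cone_dist_def[of K1 K3]
  proof (rule cSUP_least)
    fix z :: "real^'a" assume "z \<in> cball 0 1"
    then have "norm z \<le> 1" by simp
    then show "\<bar>infdist z K1 - infdist z K3\<bar> \<le> cone_dist K1 K2 + cone_dist K2 K3"
      using cone_dist_upper[OF K, of z] cone_dist_upper[OF K(2) K3, of z] by linarith
  qed simp
qed

lemma topspace_param_topology: "topspace (param_topology m l) = params m l"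
  by (simp add: param_topology_def params_def tuple_topology_def cone_topology_def
      Metric_space.topspace_mtopology[OF Metric_space_tensor_tuples]
      Metric_space.topspace_mtopology[OF Metric_space_closed_cones])

end

theory Submission
  imports Defs
begin

text \<open>Membership in a closed cone and in its dual are both equations in the distance function of the
  cone, which is jointly continuous in the point and the cone, so solution sets are closed. For (ii),
  homogenise with a parameter \<open>t\<close>: a solution \<open>x \<noteq> 0\<close> of a nearby problem gives the solution \<open>x / \<parallel>x\<parallel>\<close>
  of the homogenised problem at \<open>t = 1 / \<parallel>x\<parallel>\<close>. The \<open>R\<^sub>0\<close> condition says that there is none on the unit
  sphere at \<open>t = 0\<close>, and compactness of the sphere extends this to small \<open>t\<close> and nearby parameters.\<close>

section \<open>Continuity by majorants, and continuity of tensor entries\<close>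

text \<open>A squeeze argument: \<open>g x0\<close> tends to its value \<open>0\<close> at
  \<open>x0\<close>. It turns explicit distance estimates for tuples and cones into continuity on an
  arbitrary space \<open>X\<close>.\<close>

lemma continuous_map_dominated:
  fixes f :: "'a \<Rightarrow> 'b::metric_space" and g :: "'a \<Rightarrow> 'a \<Rightarrow> real"
  assumes g: "\<And>x0. x0 \<in> topspace X \<Longrightarrow> continuous_map X euclidean (g x0)"
    and g0: "\<And>x0. x0 \<in> topspace X \<Longrightarrow> g x0 x0 = 0"
    and le: "\<And>x0 x. \<lbrakk>x0 \<in> topspace X; x \<in> topspace X\<rbrakk> \<Longrightarrow> dist (f x) (f x0) \<le> g x0 x"
  shows "continuous_map X euclidean f"
  unfolding continuous_map_atin limitin_canonical_iff
proof
  fix x0 assume x0: "x0 \<in> topspace X"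
  have "(g x0 \<longlongrightarrow> 0) (atin X x0)"
    using g[OF x0] g0[OF x0] x0 unfolding continuous_map_atin limitin_canonical_iff by metis
  moreover have "eventually (\<lambda>x. x \<in> topspace X) (atin X x0)"
    by (auto simp: eventually_atin)
  then have "eventually (\<lambda>x. norm (dist (f x) (f x0)) \<le> g x0 x) (atin X x0)"
    by (rule eventually_mono) (use le[OF x0] in simp)
  ultimately have "((\<lambda>x. dist (f x) (f x0)) \<longlongrightarrow> 0) (atin X x0)"
    by (rule Lim_null_comparison[rotated])
  then show "(f \<longlongrightarrow> f x0) (atin X x0)"
    by (rule tendsto_dist_iff[THEN iffD2])
qed

lemma (in Metric_space) continuous_map_dist_right:
  assumes "continuous_map X mtopology f" "p \<in> M"
  shows "continuous_map X euclideanreal (\<lambda>x. d (f x) p)"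
  using assms continuous_map_mdist[of X "metric (M, d)" f "\<lambda>_. p"]
  by (simp add: Metric_space_axioms mtopology_of_def mdist_metric mspace_metric)

text \<open>A coordinate is at most the Euclidean norm, used twice: for an entry of one tensor, then
  for one tensor of the tuple.\<close>

lemma tensor_entry_diff_le_tuple_dist:
  assumes "k \<in> {1..m - 1}" "length js = m - k + 1"
  shows "\<bar>\<Lambda>1 k js - \<Lambda>2 k js\<bar> \<le> tuple_dist m \<Lambda>1 \<Lambda>2"
proof -
  have "\<bar>\<Lambda>1 k js - \<Lambda>2 k js\<bar> \<le> frob_norm (m - k + 1) (\<lambda>js. \<Lambda>1 k js - \<Lambda>2 k js)"
    using assms member_le_L2_set[OF finite_index_lists, of js "m - k + 1" "\<lambda>js. \<bar>\<Lambda>1 k js - \<Lambda>2 k js\<bar>"]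
    by (simp add: frob_norm_def L2_set_def)
  also have "\<dots> \<le> tuple_dist m \<Lambda>1 \<Lambda>2"
    using assms member_le_L2_set[of "{1..m - 1}" k
        "\<lambda>k. frob_norm (m - k + 1) (\<lambda>js. \<Lambda>1 k js - \<Lambda>2 k js)"]
    by (simp add: tuple_dist_L2)
  finally show ?thesis .
qed

lemma continuous_map_tensor_entry:
  assumes L: "continuous_map X (tuple_topology m) L"
    and k: "k \<in> {1..m - 1}" "length js = m - k + 1"
  shows "continuous_map X euclideanreal (\<lambda>x. L x k js)"
proof (rule continuous_map_dominated[where g = "\<lambda>x0 x. tuple_dist m (L x) (L x0)"])
  interpret Metric_space "tensor_tuples m :: (nat \<Rightarrow> 'b list \<Rightarrow> real) set" "tuple_dist m"
    by (rule Metric_space_tensor_tuples)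
  fix x0 assume x0: "x0 \<in> topspace X"
  then have L0: "L x0 \<in> tensor_tuples m"
    using funcset_mem[OF continuous_map_funspace[OF L]] topspace_mtopology
    by (simp only: tuple_topology_def)
  show "continuous_map X euclideanreal (\<lambda>x. tuple_dist m (L x) (L x0))"
    using L L0 unfolding tuple_topology_def by (rule continuous_map_dist_right)
  show "tuple_dist m (L x0) (L x0) = 0"
    using L0 by simp
  show "dist (L x k js) (L x0 k js) \<le> tuple_dist m (L x) (L x0)" for x
    using tensor_entry_diff_le_tuple_dist[OF k] by (simp add: dist_real_def)
qed

section \<open>The distance to a cone as a function of point and cone\<close>

text \<open>Scaling a nearest point \<open>u\<close> by \<open>c\<close> stays in \<open>K\<close>,
  which gives one inequality; the same inequality for \<open>1 / c\<close> at
  \<open>c *\<^sub>R z\<close> gives the other.\<close>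

lemma infdist_cone_scaleR:
  assumes K: "K \<in> closed_cones" and c: "c > 0"
  shows "infdist (c *\<^sub>R z) K = c * infdist z K"
proof -
  have le: "infdist (c *\<^sub>R z) K \<le> c * infdist z K" if "c > 0" for c z
  proof -
    have cl: "closed K" "K \<noteq> {}" and cone: "convex_cone K"
      using K by (auto simp: closed_cones_def convex_cone_nonempty)
    obtain u where u: "u \<in> K" "infdist z K = dist z u"
      using infdist_attains_inf[OF cl] by metis
    have "infdist (c *\<^sub>R z) K \<le> dist (c *\<^sub>R z) (c *\<^sub>R u)"
      using convex_cone_scaleR[OF cone _ u(1)] that by (simp add: infdist_le)
    also have "\<dots> = c * infdist z K"
      using u(2) that by (simp add: dist_norm flip: scaleR_diff_right)
    finally show ?thesis .
  qed
  show ?thesis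
    using le[OF c, of z] le[of "1 / c" "c *\<^sub>R z"] c by (simp add: field_simps)
qed

text \<open>\<open>cone_dist\<close> compares distances only on the unit ball, so \<open>z\<close>
  is first shrunk into it. The factor \<open>1 + norm z\<close> is positive even at
  \<open>z = 0\<close>.\<close>

lemma infdist_cone_diff_le_cone_dist:
  assumes K: "K1 \<in> closed_cones" "K2 \<in> closed_cones"
  shows "\<bar>infdist z K1 - infdist z K2\<bar> \<le> (1 + norm z) * cone_dist K1 K2"
proof -
  define c where "c = 1 + norm z"
  have c: "c > 0"
    by (simp add: c_def add_pos_nonneg)
  define w where "w = (1 / c) *\<^sub>R z"
  have z: "z = c *\<^sub>R w" and w: "norm w \<le> 1"
    using c by (auto simp: w_def c_def field_simps)
  have "\<bar>infdist z K1 - infdist z K2\<bar> = c * \<bar>infdist w K1 - infdist w K2\<bar>"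
    using c by (simp add: z infdist_cone_scaleR[OF K(1) c] infdist_cone_scaleR[OF K(2) c] abs_mult
        flip: right_diff_distrib)
  also have "\<dots> \<le> c * cone_dist K1 K2"
    using cone_dist_upper[OF K w] c by simp
  finally show ?thesis
    by (simp add: c_def)
qed

lemma continuous_map_cones_in:
  "continuous_map X cone_topology K \<Longrightarrow> x \<in> topspace X \<Longrightarrow> K x \<in> closed_cones"
  unfolding cone_topology_def
  using funcset_mem[OF continuous_map_funspace]
    Metric_space.topspace_mtopology[OF Metric_space_closed_cones] by metis

text \<open>The point moves first, with the cone \<open>K x\<close> fixed (\<open>infdist\<close> is
  1-Lipschitz); then the cone moves at the fixed point \<open>y x0\<close>, so the factor of
  \<open>cone_dist\<close> does not depend on \<open>x\<close>.\<close>

lemma continuous_map_infdist_cone: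
  fixes y :: "'a \<Rightarrow> real^'n"
  assumes y: "continuous_map X euclidean y" and K: "continuous_map X cone_topology K"
  shows "continuous_map X euclideanreal (\<lambda>x. infdist (y x) (K x))"
proof (rule continuous_map_dominated[where
      g = "\<lambda>x0 x. norm (y x - y x0) + (1 + norm (y x0)) * cone_dist (K x) (K x0)"])
  interpret Metric_space "closed_cones :: (real^'n) set set" cone_dist
    by (rule Metric_space_closed_cones)
  fix x0 assume x0: "x0 \<in> topspace X"
  note K0 = continuous_map_cones_in[OF K x0]
  have "continuous_map X euclideanreal (\<lambda>x. cone_dist (K x) (K x0))"
    using K K0 unfolding cone_topology_def by (rule continuous_map_dist_right)
  then show "continuous_map X euclideanreal
      (\<lambda>x. norm (y x - y x0) + (1 + norm (y x0)) * cone_dist (K x) (K x0))"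
    by (intro continuous_intros y) auto
  show "norm (y x0 - y x0) + (1 + norm (y x0)) * cone_dist (K x0) (K x0) = 0"
    using K0 by simp
  fix x assume "x \<in> topspace X"
  then show "dist (infdist (y x) (K x)) (infdist (y x0) (K x0))
      \<le> norm (y x - y x0) + (1 + norm (y x0)) * cone_dist (K x) (K x0)"
    using infdist_cone_diff_le_cone_dist[OF continuous_map_cones_in[OF K] K0, of x "y x0"]
      infdist_triangle_abs[of "y x" "K x" "y x0"]
    by (simp add: dist_real_def dist_norm)
qed

text \<open>The projection of \<open>- y\<close> onto \<open>K\<close> is \<open>0\<close> exactly when \<open>y\<close> lies in the dual cone.\<close>

lemma dual_cone_iff_infdist:
  assumes K: "K \<in> closed_cones"
  shows "y \<in> dual_cone K \<longleftrightarrow> infdist (- y) K = norm y"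
proof
  have cone: "convex_cone K" and ne: "K \<noteq> {}"
    using K by (auto simp: closed_cones_def convex_cone_nonempty)
  have sq: "(norm (y + u))\<^sup>2 = (norm y)\<^sup>2 + 2 * (y \<bullet> u) + (norm u)\<^sup>2" for u
    by (simp add: power2_norm_eq_inner inner_simps inner_commute)
  have dist: "dist (- y) u = norm (y + u)" for u
    using norm_minus_cancel[of "y + u"] by (simp add: dist_norm)
  show "infdist (- y) K = norm y" if "y \<in> dual_cone K"
  proof (rule antisym)
    show "infdist (- y) K \<le> norm y"
      using infdist_cone_le_norm[OF K, of "- y"] by simp
    have "norm y \<le> norm (y + u)" if "u \<in> K" for u
    proof (rule power2_le_imp_le)
      show "(norm y)\<^sup>2 \<le> (norm (y + u))\<^sup>2"
        using \<open>y \<in> dual_cone K\<close> that by (simp add: sq dual_cone_def)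
    qed simp
    then show "norm y \<le> infdist (- y) K"
      by (simp add: infdist_notempty[OF ne] dist cINF_greatest[OF ne])
  qed
  show "y \<in> dual_cone K" if eq: "infdist (- y) K = norm y"
    unfolding dual_cone_def
  proof (intro CollectI ballI)
    fix u assume u: "u \<in> K"
    \<comment> \<open>On the ray through \<open>u\<close> the distance to \<open>- y\<close> is
      least at the apex \<open>0\<close>. Expanding the square and dividing by \<open>t\<close>
      gives this bound; letting \<open>t\<close> tend to \<open>0\<close> from the right leaves the
      sign of \<open>y \<bullet> u\<close>.\<close>
    have bound: "0 \<le> 2 * (y \<bullet> u) + t * (norm u)\<^sup>2" if t: "t > 0" for t
    proof -
      have "norm y \<le> norm (y + t *\<^sub>R u)"
        using infdist_le[OF convex_cone_scaleR[OF cone _ u, of t], of "- y"] t eq by (simp add: dist)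
      then have "(norm y)\<^sup>2 \<le> (norm (y + t *\<^sub>R u))\<^sup>2"
        by simp
      then have "0 \<le> t * (2 * (y \<bullet> u) + t * (norm u)\<^sup>2)"
        unfolding sq by (simp add: power_mult_distrib algebra_simps power2_eq_square)
      then show ?thesis
        using t by (simp add: zero_le_mult_iff)
    qed
    have "((\<lambda>t. 2 * (y \<bullet> u) + t * (norm u)\<^sup>2) \<longlongrightarrow> 2 * (y \<bullet> u) + 0 * (norm u)\<^sup>2) (at_right 0)"
      by (intro tendsto_intros)
    then have "0 \<le> 2 * (y \<bullet> u) + 0 * (norm u)\<^sup>2"
      by (rule tendsto_lowerbound) (auto simp: eventually_at_filter bound)
    then show "0 \<le> y \<bullet> u"
      by simp
  qed
qed

section \<open>Complementarity as a closed condition\<close>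

text \<open>Common form of the original problem, the homogenised one and the condition excluded by
  \<open>R0_tensor_pair\<close>, which differ only in \<open>y\<close> and \<open>z\<close>.\<close>

definition complementary :: "(real^'n) set \<Rightarrow> real^'n \<Rightarrow> real^'n \<Rightarrow> bool" where
  "complementary K y z \<longleftrightarrow> y \<in> K \<and> z \<in> dual_cone K \<and> y \<bullet> z = 0"

lemma SOL_iff_complementary:
  "x \<in> SOL m l (\<Lambda>, a, \<Theta>, b, K) \<longleftrightarrow> complementary K (poly_map m \<Lambda> a x) (poly_map l \<Theta> b x)"
  by (simp add: SOL_def complementary_def)

text \<open>Two independent factors are needed because the homogenised maps scale by
  \<open>t ^ (m - 1)\<close> and \<open>t ^ (l - 1)\<close>.\<close>

lemma complementary_scaleR:
  assumes "K \<in> closed_cones" "0 \<le> s" "0 \<le> t" "complementary K y z"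
  shows "complementary K (s *\<^sub>R y) (t *\<^sub>R z)"
  using assms by (auto simp: complementary_def dual_cone_def closed_cones_def convex_cone_scaleR)

text \<open>All three summands are nonnegative, the middle one because \<open>0\<close> lies in
  \<open>K\<close>. Hence the three conditions merge into a single equation.\<close>

lemma complementary_iff_infdist:
  assumes K: "K \<in> closed_cones"
  shows "complementary K y z \<longleftrightarrow> infdist y K + (norm z - infdist (- z) K) + \<bar>y \<bullet> z\<bar> = 0"
proof -
  have "y \<in> K \<longleftrightarrow> infdist y K = 0"
    using K by (intro in_closed_iff_infdist_zero) (auto simp: closed_cones_def convex_cone_nonempty)
  then have "complementary K y z \<longleftrightarrow> infdist y K = 0 \<and> infdist (- z) K = norm z \<and> y \<bullet> z = 0"
    unfolding complementary_def dual_cone_iff_infdist[OF K] by argo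
  also have "\<dots> \<longleftrightarrow> infdist y K + (norm z - infdist (- z) K) + \<bar>y \<bullet> z\<bar> = 0"
    using infdist_nonneg[of y K] infdist_cone_le_norm[OF K, of "- z"] norm_minus_cancel[of z]
    by linarith
  finally show ?thesis .
qed

lemma continuous_map_inner:
  fixes y z :: "'a \<Rightarrow> 'b::real_inner"
  assumes "continuous_map X euclidean y" "continuous_map X euclidean z"
  shows "continuous_map X euclideanreal (\<lambda>x. y x \<bullet> z x)"
  using assms by (simp add: continuous_map_atin tendsto_inner)

lemma closedin_complementary:
  fixes y z :: "'a \<Rightarrow> real^'n"
  assumes y: "continuous_map X euclidean y" and z: "continuous_map X euclidean z"
    and K: "continuous_map X cone_topology K"
  shows "closedin X {x \<in> topspace X. complementary (K x) (y x) (z x)}"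
proof -
  let ?h = "\<lambda>x. infdist (y x) (K x) + (norm (z x) - infdist (- z x) (K x)) + \<bar>y x \<bullet> z x\<bar>"
  have "continuous_map X euclideanreal ?h"
    by (intro continuous_intros continuous_map_infdist_cone continuous_map_inner y z K)
  then have "closedin X {x \<in> topspace X. ?h x \<in> {0}}"
    by (rule closedin_continuous_map_preimage) simp
  moreover have "{x \<in> topspace X. ?h x \<in> {0}} = {x \<in> topspace X. complementary (K x) (y x) (z x)}"
    using complementary_iff_infdist[OF continuous_map_cones_in[OF K]] by auto
  ultimately show ?thesis
    by simp
qed

section \<open>Homogenisation of the polynomial maps\<close>

text \<open>\<open>hom_poly_map m \<Lambda> a t u\<close> is \<open>t\<^sup>m\<^sup>-\<^sup>1 F(u / t)\<close>, extended continuously to \<open>t = 0\<close>.\<close>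

definition hom_poly_map ::
  "nat \<Rightarrow> (nat \<Rightarrow> 'n::finite list \<Rightarrow> real) \<Rightarrow> real^'n \<Rightarrow> real \<Rightarrow> real^'n \<Rightarrow> real^'n" where
  "hom_poly_map m \<Lambda> a t u =
     (\<Sum>k=1..m - 1. t ^ (k - 1) *\<^sub>R tensor_apply (m - k + 1) (\<Lambda> k) u) + t ^ (m - 1) *\<^sub>R a"

lemma hom_poly_map_1: "hom_poly_map m \<Lambda> a 1 u = poly_map m \<Lambda> a u"
  by (simp add: hom_poly_map_def poly_map_def)

text \<open>Links \<open>t = 0\<close> to the leading tensors: since \<open>0 ^ 0 = 1\<close> the
  term \<open>k = 1\<close> survives, while \<open>m \<ge> 2\<close> makes the constant term
  vanish.\<close>

lemma hom_poly_map_0: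
  assumes "m \<ge> 2"
  shows "hom_poly_map m \<Lambda> a 0 u = tensor_apply m (\<Lambda> 1) u"
proof -
  have "hom_poly_map m \<Lambda> a 0 u
      = (\<Sum>k=1..m - 1. if k = 1 then tensor_apply (m - k + 1) (\<Lambda> k) u else 0)"
  proof -
    have "(0::real) ^ (m - 1) = 0"
      using assms by simp
    moreover have "0 ^ (k - 1) *\<^sub>R tensor_apply (m - k + 1) (\<Lambda> k) u
        = (if k = 1 then tensor_apply (m - k + 1) (\<Lambda> k) u else 0)" if "k \<in> {1..m - 1}" for k
      using that by (auto simp: power_0_left)
    ultimately show ?thesis
      unfolding hom_poly_map_def by (simp only: scaleR_zero_left add_0_right cong: sum.cong)
  qed
  also have "\<dots> = tensor_apply m (\<Lambda> 1) u"
    using assms by (subst sum.delta) auto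
  finally show ?thesis .
qed

lemma tensor_apply_scaleR: "tensor_apply m A (c *\<^sub>R x) = c ^ (m - 1) *\<^sub>R tensor_apply m A x"
  by (simp add: tensor_apply_def vec_eq_iff prod.distrib sum_distrib_left mult_ac)

text \<open>The \<open>k\<close>-th term is homogeneous of degree \<open>m - k\<close>, and its
  weight \<open>t ^ (k - 1)\<close> raises every exponent to \<open>m - 1\<close>.\<close>

lemma hom_poly_map_scaleR: "hom_poly_map m \<Lambda> a t (t *\<^sub>R x) = t ^ (m - 1) *\<^sub>R poly_map m \<Lambda> a x"
proof -
  have "t ^ (k - 1) *\<^sub>R tensor_apply (m - k + 1) (\<Lambda> k) (t *\<^sub>R x)
      = t ^ (m - 1) *\<^sub>R tensor_apply (m - k + 1) (\<Lambda> k) x" if "k \<in> {1..m - 1}" for k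
  proof -
    have "k - 1 + (m - k + 1 - 1) = m - 1"
      using that by auto
    then show ?thesis
      by (simp only: tensor_apply_scaleR scaleR_scaleR flip: power_add)
  qed
  then show ?thesis
    by (simp add: hom_poly_map_def poly_map_def scaleR_add_right scaleR_sum_right)
qed

section \<open>Closedness of solution sets\<close>

lemma continuous_map_vec_nth:
  "continuous_map X euclidean (f :: 'a \<Rightarrow> real^'n) \<Longrightarrow> continuous_map X euclideanreal (\<lambda>x. f x $ i)"
  by (simp add: continuous_map_atin tendsto_vec_nth)

lemma continuous_map_vec_lambda:
  "(\<And>i. continuous_map X euclideanreal (f i)) \<Longrightarrow> continuous_map X euclidean (\<lambda>x. \<chi> i. f i x)"
  by (simp add: continuous_map_atin tendsto_vec_lambda)

lemma continuous_map_scaleR: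
  fixes f :: "'a \<Rightarrow> 'b::real_normed_vector"
  shows "continuous_map X euclideanreal c \<Longrightarrow> continuous_map X euclidean f \<Longrightarrow>
    continuous_map X euclidean (\<lambda>x. c x *\<^sub>R f x)"
  by (simp add: continuous_map_atin tendsto_scaleR)

lemma continuous_map_hom_poly_map:
  fixes a u :: "'a \<Rightarrow> real^'n"
  assumes L: "continuous_map X (tuple_topology m) L" and a: "continuous_map X euclidean a"
    and t: "continuous_map X euclideanreal t" and u: "continuous_map X euclidean u"
  shows "continuous_map X euclidean (\<lambda>x. hom_poly_map m (L x) (a x) (t x) (u x))"
proof -
  have "continuous_map X euclidean (\<lambda>x. tensor_apply (m - k + 1) (L x k) (u x))"
    if k: "k \<in> {1..m - 1}" for k
    unfolding tensor_apply_def
  proof (rule continuous_map_vec_lambda, rule continuous_map_sum[OF finite_index_lists])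
    fix j js assume "js \<in> {js :: 'n list. length js = m - k + 1 - 1}"
    then have "continuous_map X euclideanreal (\<lambda>x. L x k (j # js))"
      by (intro continuous_map_tensor_entry[OF L k]) simp
    then show "continuous_map X euclideanreal
        (\<lambda>x. L x k (j # js) * (\<Prod>i<m - k + 1 - 1. u x $ (js ! i)))"
      by (rule continuous_map_real_mult)
        (rule continuous_map_prod[OF finite_lessThan continuous_map_vec_nth[OF u]])
  qed
  then show ?thesis
    unfolding hom_poly_map_def
    by (intro continuous_map_add continuous_map_sum continuous_map_scaleR continuous_map_real_pow
        finite_atLeastAtMost a t)
qed

text \<open>With \<open>p\<close>, \<open>t\<close> and \<open>u\<close> arbitrary continuous maps,
  this covers the original problem (\<open>t\<close> constantly \<open>1\<close>), a single
  parameter (\<open>p\<close> constant) and the compactness argument, where all three vary.\<close>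

lemma closedin_hom_solutions:
  fixes p :: "'a \<Rightarrow> 'n::finite param" and u :: "'a \<Rightarrow> real^'n"
  assumes p: "continuous_map X (param_topology m l) p"
    and t: "continuous_map X euclideanreal t" and u: "continuous_map X euclidean u"
  shows "closedin X {x \<in> topspace X. case p x of (\<Lambda>, a, \<Theta>, b, K) \<Rightarrow>
      complementary K (hom_poly_map m \<Lambda> a (t x) (u x)) (hom_poly_map l \<Theta> b (t x) (u x))}"
proof -
  note p' = p[unfolded param_topology_def continuous_map_pairwise o_def]
  show ?thesis
    unfolding case_prod_unfold
    by (intro closedin_complementary continuous_map_hom_poly_map t u) (use p' in blast)+
qed

lemma SOL_iff_hom_1:
  "x \<in> SOL m l p \<longleftrightarrow> (case p of (\<Lambda>, a, \<Theta>, b, K) \<Rightarrow>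
      complementary K (hom_poly_map m \<Lambda> a 1 x) (hom_poly_map l \<Theta> b 1 x))"
  by (cases p) (simp add: SOL_iff_complementary hom_poly_map_1)

lemma closedin_SOL:
  assumes "continuous_map X (param_topology m l) p" "continuous_map X euclidean u"
  shows "closedin X {x \<in> topspace X. u x \<in> SOL m l (p x)}"
  unfolding SOL_iff_hom_1
  using assms by (intro closedin_hom_solutions[where t = "\<lambda>_. 1"]) simp_all

section \<open>Local boundedness under the \<open>R0\<close> condition\<close>

lemma locally_bounded_SOL:
  fixes \<Lambda> :: "nat \<Rightarrow> 'n::finite list \<Rightarrow> real"
  assumes ml: "m \<ge> 2" "l \<ge> 2" and p: "(\<Lambda>, a, \<Theta>, b, K) \<in> params m l"
    and R0: "R0_tensor_pair m l K (\<Lambda> 1) (\<Theta> 1)"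
  shows "locally_bounded_at (param_topology m l) (SOL m l) (\<Lambda>, a, \<Theta>, b, K)"
proof -
  let ?P = "param_topology m l :: 'n param topology"
  let ?S = "top_of_set (sphere 0 1 :: (real^'n) set)"
  let ?Y = "prod_topology ?P euclideanreal"
  let ?X = "prod_topology ?Y ?S"
  define C where "C = {x \<in> topspace ?X. case fst (fst x) of (\<Lambda>, a, \<Theta>, b, K) \<Rightarrow>
      complementary K (hom_poly_map m \<Lambda> a (snd (fst x)) (snd x))
        (hom_poly_map l \<Theta> b (snd (fst x)) (snd x))}"
  have "closedin ?X C"
    unfolding C_def
  proof (rule closedin_hom_solutions[where p = "\<lambda>x. fst (fst x)"
        and t = "\<lambda>x. snd (fst x)" and u = snd])
    show "continuous_map ?X ?P (\<lambda>x. fst (fst x))"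
      "continuous_map ?X euclideanreal (\<lambda>x. snd (fst x))"
      using continuous_map_compose[OF continuous_map_fst continuous_map_fst]
        continuous_map_compose[OF continuous_map_fst continuous_map_snd]
      by (force simp: o_def)+
    show "continuous_map ?X euclidean snd"
      using continuous_map_snd continuous_map_into_fulltopology by blast
  qed
  \<comment> \<open>Projection along a compact factor is closed; this is where compactness of the
    sphere enters.\<close>
  moreover have "closed_map ?X ?Y fst"
    by (rule closed_map_fst) (simp add: compact_space_subtopology compactin_euclidean_iff)
  ultimately have "closedin ?Y (fst ` C)"
    unfolding closed_map_def by blast
  then have op: "openin ?Y (topspace ?Y - fst ` C)"
    by blast
  \<comment> \<open>At \<open>t = 0\<close> only the leading tensors remain, and points of the
    sphere are nonzero.\<close>
  have "((\<Lambda>, a, \<Theta>, b, K), 0) \<notin> fst ` C"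
    using R0 by (auto simp: C_def R0_tensor_pair_def complementary_def hom_poly_map_0 ml)
  then have "((\<Lambda>, a, \<Theta>, b, K), 0) \<in> topspace ?Y - fst ` C"
    using p by (simp add: topspace_param_topology)
  with op obtain U V where U: "openin ?P U" "(\<Lambda>, a, \<Theta>, b, K) \<in> U"
    and V: "open V" "0 \<in> V" and UV: "U \<times> V \<subseteq> topspace ?Y - fst ` C"
    unfolding openin_prod_topology_alt by (metis open_openin)
  obtain e where e: "e > 0" "ball 0 e \<subseteq> V"
    using V by (meson openE)
  \<comment> \<open>A solution longer than \<open>1 / e\<close> would have
    \<open>t = 1 / norm x\<close> inside \<open>V\<close>, and \<open>t *\<^sub>R x\<close> on the
    sphere would put \<open>(q, t)\<close> into the projection of \<open>C\<close>.\<close>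
  have "norm x \<le> 1 / e" if "q \<in> U" "x \<in> SOL m l q" for q x
  proof (rule ccontr)
    assume "\<not> norm x \<le> 1 / e"
    then have x: "norm x > 1 / e"
      by simp
    then have pos: "norm x > 0"
      using e(1) by (meson divide_pos_pos less_trans zero_less_one)
    define t where "t = 1 / norm x"
    have t: "t > 0" "t < e"
      using x pos e(1) by (auto simp: t_def field_simps)
    obtain \<Lambda>' a' \<Theta>' b' K' where q: "q = (\<Lambda>', a', \<Theta>', b', K')"
      by (cases q)
    have qP: "q \<in> params m l"
      using U(1) \<open>q \<in> U\<close> openin_subset topspace_param_topology by blast
    then have "complementary K' (t ^ (m - 1) *\<^sub>R poly_map m \<Lambda>' a' x) (t ^ (l - 1) *\<^sub>R poly_map l \<Theta>' b' x)"
      using \<open>x \<in> SOL m l q\<close> t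
      by (intro complementary_scaleR) (auto simp: q params_def SOL_iff_complementary)
    moreover have "norm (t *\<^sub>R x) = 1"
      using pos by (simp add: t_def)
    ultimately have "((q, t), t *\<^sub>R x) \<in> C"
      using qP by (simp add: C_def q hom_poly_map_scaleR topspace_param_topology)
    then have "(q, t) \<in> fst ` C"
      by force
    moreover have "(q, t) \<in> U \<times> V"
      using \<open>q \<in> U\<close> e(2) t by (auto simp: dist_real_def)
    ultimately show False
      using UV by blast
  qed
  then have "bounded (\<Union>q\<in>U. SOL m l q)"
    unfolding bounded_iff by blast
  then show ?thesis
    unfolding locally_bounded_at_def using U openin_subset by blast
qed

theorem proposition4p2:
  fixes m l :: nat
  assumes "CARD('n::finite) \<ge> 2" and "m \<ge> 2" and "l \<ge> 2"
  shows
    "closedin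
       (prod_topology (tuple_topology m) (prod_topology euclidean
         (prod_topology (tuple_topology l) (prod_topology euclidean
           (prod_topology cone_topology euclidean)))))
       {(\<Lambda> :: nat \<Rightarrow> 'n list \<Rightarrow> real, a, \<Theta>, b, K, x).
          (\<Lambda>, a, \<Theta>, b, K) \<in> params m l \<and> x \<in> SOL m l (\<Lambda>, a, \<Theta>, b, K)}
     \<and> (\<forall>\<Xi> \<in> (params m l :: 'n param set). closed (SOL m l \<Xi>))
     \<and> (\<forall>\<Lambda> a \<Theta> b K. (\<Lambda>, a, \<Theta>, b, K) \<in> (params m l :: 'n param set) \<longrightarrow>
          R0_tensor_pair m l K (\<Lambda> 1) (\<Theta> 1) \<longrightarrow>
          locally_bounded_at (param_topology m l) (SOL m l) (\<Lambda>, a, \<Theta>, b, K))"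
proof (intro conjI ballI allI impI)
  let ?X = "prod_topology (tuple_topology m :: (nat \<Rightarrow> 'n list \<Rightarrow> real) topology)
      (prod_topology (euclidean :: (real^'n) topology)
         (prod_topology (tuple_topology l :: (nat \<Rightarrow> 'n list \<Rightarrow> real) topology)
            (prod_topology (euclidean :: (real^'n) topology)
           (prod_topology (cone_topology :: (real^'n) set topology) (euclidean :: (real^'n) topology)))))"
  let ?p = "\<lambda>(\<Lambda>, a, \<Theta>, b, K, x). (\<Lambda>, a, \<Theta>, b, K) :: 'n param"
  let ?x = "\<lambda>(\<Lambda>, a, \<Theta>, b, K, x). x"
  \<comment> \<open>Read componentwise, continuity of the identity yields that of all six
    coordinates, which \<open>?p\<close> and \<open>?x\<close> merely regroup.\<close>
  have id: "continuous_map ?X ?X (\<lambda>x. x)"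
    by simp
  have "continuous_map ?X (param_topology m l) ?p" "continuous_map ?X euclidean ?x"
    unfolding param_topology_def case_prod_unfold
    using id[unfolded continuous_map_pairwise o_def]
    by (simp_all add: continuous_map_pairwise o_def)
  then have "closedin ?X {x \<in> topspace ?X. ?x x \<in> SOL m l (?p x)}"
    by (rule closedin_SOL)
  moreover have "{x \<in> topspace ?X. ?x x \<in> SOL m l (?p x)} = {(\<Lambda>, a, \<Theta>, b, K, x).
          (\<Lambda>, a, \<Theta>, b, K) \<in> params m l \<and> x \<in> SOL m l (\<Lambda>, a, \<Theta>, b, K)}"
    by (auto simp: param_topology_def simp flip: topspace_param_topology)
  ultimately show "closedin ?X {(\<Lambda>, a, \<Theta>, b, K, x).
          (\<Lambda>, a, \<Theta>, b, K) \<in> params m l \<and> x \<in> SOL m l (\<Lambda>, a, \<Theta>, b, K)}"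
    by simp
next
  fix \<Xi> :: "'n param"
  assume "\<Xi> \<in> params m l"
  \<comment> \<open>Here the parameter map is constant and the space is that of \<open>x\<close>
    alone.\<close>
  then have "closedin euclidean {x \<in> topspace euclidean. x \<in> SOL m l \<Xi>}"
    by (intro closedin_SOL) (simp_all add: topspace_param_topology)
  then show "closed (SOL m l \<Xi>)"
    by simp
next
  fix \<Lambda> \<Theta> :: "nat \<Rightarrow> 'n list \<Rightarrow> real" and a b K
  assume "(\<Lambda>, a, \<Theta>, b, K) \<in> params m l" "R0_tensor_pair m l K (\<Lambda> 1) (\<Theta> 1)"
  then show "locally_bounded_at (param_topology m l) (SOL m l) (\<Lambda>, a, \<Theta>, b, K)"
    by (rule locally_bounded_SOL[OF assms(2,3)])
qed

end
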